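(* Let $X$ be a pre-Riesz space with a vector lattice cover $(Y,i)$ and let $I\subseteq X$ be an ideal. Then the following statements are equivalent: (i) $I$ is directed. (ii) There exists a set $S\subseteq X_+$ of positive elements such that $I=\mathcal{I}_S$. (iii) The set $i(I)$ is majorizing in $\mathcal{I}_{i(I)}$ (the ideal of $Y$ generated by $i(I)$). (iv) $I$ has an extension ideal in $Y$, and for the smallest extension ideal $\hat{I}$ of $I$ in $Y$ there exists a set $S\subseteq X_+$ such that $\hat{I}=\mathcal{I}_{i(S)}$ (the ideal of $Y$ generated by $i(S)$). If one of these statements is true, then in (ii) and (iv) one can choose $S:=I_+$, where $I_+=I\cap X_+$.
   Context: All ordered vector spaces are real vector spaces with a partial order given by a cone $X_+$ ($x\le y$ iff $y-x\in X_+$); linear subspaces carry the induced order. A linear subspace $D$ is directed if any two elements of $D$ have an upper bound in $D$. A linear subspace $D$ of an ordered vector space $Z$ is majorizing in $Z$ if every $z\in Z$ satisfies $z\le d$ for some $d\in D$, and order dense in $Z$ if for every $z\in Z$ one has $z=\inf\{d\in D: z\le d\}$ (infimum in $Z$). A linear map $i$ is bipositive if $i(x)\ge 0\iff x\ge 0$. An ordered vector space $X$ is pre-Riesz if there are a vector lattice $Y$ and a bipositive linear map $i\colon X\to Y$ with $i(X)$ order dense in $Y$; then $(Y,i)$ is called a vector lattice cover of $X$. For $M\subseteq X$ let $M^u$ be the set of upper bounds of $M$ in $X$. A set $M\subseteq X$ is solid if $x\in X$, $y\in M$ and $\{x,-x\}^u\supseteq\{y,-y\}^u$ imply $x\in M$.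 An ideal is a solid linear subspace (in a vector lattice this is the usual notion). For a subset $M$ of an ordered vector space, $\mathcal{I}_M$ denotes the intersection of all ideals containing $M$ (the ideal generated by $M$). An ideal $J$ of $Y$ is an extension ideal of an ideal $I$ of $X$ if $I=\{x\in X: i(x)\in J\}$. If $I$ has an extension ideal, the intersection $\hat I$ of all extension ideals of $I$ in $Y$ is the smallest extension ideal of $I$ in $Y$. *)

theory Defs
  imports Complex_Main "HOL-Library.Lub_Glb"
begin

text \<open>
  Ordered vector spaces are types of class \<^class>\<open>ordered_real_vector\<close>; vector lattices are types of
  sort \<open>{ordered_real_vector, lattice}\<close> (both classes share one partial order). The cone of a space
  is the set \<open>{0..}\<close> of its nonnegative elements.
\<close>

definition upper_bounds :: "'a::ord set \<Rightarrow> 'a set" where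
  "upper_bounds M = {b. \<forall>a\<in>M. a \<le> b}"

definition directed_set :: "'a::ord set \<Rightarrow> bool" where
  "directed_set D \<longleftrightarrow> (\<forall>x\<in>D. \<forall>y\<in>D. \<exists>z\<in>D. x \<le> z \<and> y \<le> z)"

definition majorizing_in :: "'a::ordered_real_vector set \<Rightarrow> 'a set \<Rightarrow> bool" where
  "majorizing_in D Z \<longleftrightarrow> subspace D \<and> D \<subseteq> Z \<and> (\<forall>z\<in>Z. \<exists>d\<in>D. z \<le> d)"

text \<open>Order density in the whole space.\<close>

definition order_dense :: "'a::ordered_real_vector set \<Rightarrow> bool" where
  "order_dense D \<longleftrightarrow> subspace D \<and> (\<forall>z. isGlb UNIV {d\<in>D. z \<le> d} z)"

definition bipositive :: "('a::ordered_real_vector \<Rightarrow> 'b::ordered_real_vector) \<Rightarrow> bool" where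
  "bipositive i \<longleftrightarrow> linear i \<and> (\<forall>x. 0 \<le> i x \<longleftrightarrow> 0 \<le> x)"

text \<open>
  The pair \<open>(Y, i)\<close> is represented by \<open>i\<close> alone, \<open>Y\<close> being its codomain type. An ordered vector space
  is pre-Riesz iff it has a vector lattice cover. A predicate for this would have to quantify over
  the type \<open>'b\<close>, so pre-Riesz spaces enter only through a given cover.
\<close>

definition vector_lattice_cover ::
    "('a::ordered_real_vector \<Rightarrow> 'b::{ordered_real_vector,lattice}) \<Rightarrow> bool" where
  "vector_lattice_cover i \<longleftrightarrow> bipositive i \<and> order_dense (range i)"

definition solid :: "'a::ordered_real_vector set \<Rightarrow> bool" where
  "solid M \<longleftrightarrow> (\<forall>x. \<forall>y\<in>M. upper_bounds {y, - y} \<subseteq> upper_bounds {x, - x} \<longrightarrow> x \<in> M)"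

definition order_ideal :: "'a::ordered_real_vector set \<Rightarrow> bool" where
  "order_ideal I \<longleftrightarrow> subspace I \<and> solid I"

definition generated_ideal :: "'a::ordered_real_vector set \<Rightarrow> 'a set" where
  "generated_ideal M = order_ideal hull M"

definition extension_ideal ::
    "('a::ordered_real_vector \<Rightarrow> 'b::ordered_real_vector) \<Rightarrow> 'a set \<Rightarrow> 'b set \<Rightarrow> bool" where
  "extension_ideal i I J \<longleftrightarrow> order_ideal J \<and> I = {x. i x \<in> J}"

text \<open>Meaningful only if \<open>I\<close> has an extension ideal; otherwise this is the whole space.\<close>

definition smallest_extension_ideal ::
    "('a::ordered_real_vector \<Rightarrow> 'b::ordered_real_vector) \<Rightarrow> 'a set \<Rightarrow> 'b set" where
  "smallest_extension_ideal i I = \<Inter>{J. extension_ideal i I J}"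

end

theory Submission
  imports Defs
begin

text \<open>
  For a subspace \<open>D\<close>, the elements \<open>y\<close> with \<open>\<plusminus>y \<le> d\<close> for some \<open>d \<in> D\<close> form an ideal, contained in
  every ideal that contains \<open>D \<inter> {0..}\<close>. An ideal \<open>I\<close> is directed iff it is contained in (hence
  equal to) the set that it dominates, and bipositivity carries this criterion over to \<open>i ` I\<close>.
  So for directed \<open>I\<close> the set dominated by \<open>i ` I\<close> is at once the ideal generated by \<open>i ` I\<close>, the
  ideal generated by \<open>i ` (I \<inter> {0..})\<close> and the smallest extension ideal of \<open>I\<close>. Conversely, an
  ideal generated by positive elements of \<open>D\<close> lies in the set dominated by \<open>D\<close>.
\<close>

text \<open>A common bound of \<open>y\<close> and \<open>- y\<close> stands in for a bound of the
  modulus, which need not exist outside a vector lattice.\<close>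

definition dominated :: "'a::ordered_real_vector set \<Rightarrow> 'a set" where
  "dominated D = {y. \<exists>d\<in>D. y \<le> d \<and> - y \<le> d}"

text \<open>Shows that dominating elements lie in the cone, so \<open>dominated D\<close> depends
  only on \<open>D \<inter> {0..}\<close>.\<close>

lemma nonneg_if_dominates:
  fixes y d :: "'a::ordered_real_vector"
  assumes "y \<le> d" "- y \<le> d"
  shows "0 \<le> d"
proof -
  have "0 \<le> d + d" using add_mono[OF assms] by simp
  then have "0 \<le> (1/2::real) *\<^sub>R (d + d)" by (intro scaleR_nonneg_nonneg) auto
  also have "(1/2::real) *\<^sub>R (d + d) = d" by (simp flip: scaleR_2)
  finally show ?thesis .
qed

lemma upper_bounds_pair_iff: "b \<in> upper_bounds {y, - y} \<longleftrightarrow> y \<le> b \<and> - y \<le> b"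
  for b :: "'a::ordered_real_vector"
  by (auto simp: upper_bounds_def)

text \<open>Solidity is immediate: \<open>y\<close> is dominated iff \<open>D\<close> meets
  \<open>upper_bounds {y, - y}\<close>. Bounds add up under sums, and a multiple by \<open>c\<close>
  is bounded by the multiple of the bound by \<open>\<bar>c\<bar>\<close>.\<close>

lemma order_ideal_dominated:
  fixes D :: "'a::ordered_real_vector set"
  assumes D: "subspace D"
  shows "order_ideal (dominated D)"
proof -
  have zero: "0 \<in> dominated D"
    using subspace_0[OF D] by (force simp: dominated_def)
  have add: "x + y \<in> dominated D" if "x \<in> dominated D" "y \<in> dominated D" for x y
  proof -
    from that obtain d e where d: "d \<in> D" "x \<le> d" "- x \<le> d" and e: "e \<in> D" "y \<le> e" "- y \<le> e"
      by (auto simp: dominated_def)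
    have "x + y \<le> d + e" "- (x + y) \<le> d + e"
      using add_mono[OF d(2) e(2)] add_mono[OF d(3) e(3)] by simp_all
    then show ?thesis using subspace_add[OF D d(1) e(1)] by (auto simp: dominated_def)
  qed
  have scale: "c *\<^sub>R x \<in> dominated D" if "x \<in> dominated D" for c x
  proof -
    from that obtain d where d: "d \<in> D" "x \<le> d" "- x \<le> d" by (auto simp: dominated_def)
    have "c *\<^sub>R x \<le> \<bar>c\<bar> *\<^sub>R d \<and> - (c *\<^sub>R x) \<le> \<bar>c\<bar> *\<^sub>R d"
    proof (cases "0 \<le> c")
      case True
      then show ?thesis
        using scaleR_left_mono[OF d(2), of c] scaleR_left_mono[OF d(3), of c] by simp
    next
      case False
      then show ?thesis
        using scaleR_left_mono[OF d(2), of "- c"] scaleR_left_mono[OF d(3), of "- c"] by simp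
    qed
    then show ?thesis using subspace_scale[OF D d(1)] by (auto simp: dominated_def)
  qed
  have "solid (dominated D)"
    unfolding solid_def
  proof (intro allI ballI impI)
    fix x y
    assume "y \<in> dominated D" and sub: "upper_bounds {y, - y} \<subseteq> upper_bounds {x, - x}"
    then obtain d where "d \<in> D" "d \<in> upper_bounds {y, - y}"
      by (auto simp: dominated_def upper_bounds_pair_iff)
    with sub have "x \<le> d \<and> - x \<le> d"
      unfolding upper_bounds_pair_iff[symmetric] by blast
    with \<open>d \<in> D\<close> show "x \<in> dominated D" by (auto simp: dominated_def)
  qed
  with zero add scale show ?thesis by (auto simp: order_ideal_def subspace_def)
qed

text \<open>A dominating \<open>d\<close> is positive, hence in \<open>J\<close>. Whatever lies
  above \<open>d\<close> lies above \<open>y\<close> and \<open>- y\<close>, so solidity of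
  \<open>J\<close> applies.\<close>

lemma dominated_subset_order_ideal:
  fixes D :: "'a::ordered_real_vector set"
  assumes J: "order_ideal J" and sub: "D \<inter> {0..} \<subseteq> J"
  shows "dominated D \<subseteq> J"
proof
  fix y assume "y \<in> dominated D"
  then obtain d where d: "d \<in> D" "y \<le> d" "- y \<le> d" by (auto simp: dominated_def)
  have "d \<in> J" using d nonneg_if_dominates[of y d] sub by auto
  moreover have "upper_bounds {d, - d} \<subseteq> upper_bounds {y, - y}"
    using d order_trans[of _ d] by (auto simp: upper_bounds_pair_iff)
  ultimately show "y \<in> J" using J unfolding order_ideal_def solid_def by blast
qed

lemma nonneg_subset_dominated: "D \<inter> {0..} \<subseteq> dominated D"
  for D :: "'a::ordered_real_vector set"
proof
  fix y assume "y \<in> D \<inter> {0..}"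
  moreover from this have "- y \<le> y" using order_trans[of "- y" 0 y] by auto
  ultimately show "y \<in> dominated D" by (auto simp: dominated_def)
qed

text \<open>An upper bound of \<open>x\<close> and \<open>- x\<close> in \<open>D\<close> dominates
  \<open>x\<close>. Conversely, dominating elements of \<open>x\<close> and \<open>y\<close> are
  positive, so their sum is above both \<open>x\<close> and \<open>y\<close>.\<close>

lemma directed_set_iff_dominated:
  fixes D :: "'a::ordered_real_vector set"
  assumes D: "subspace D"
  shows "directed_set D \<longleftrightarrow> D \<subseteq> dominated D"
proof
  assume dir: "directed_set D"
  show "D \<subseteq> dominated D"
  proof
    fix x assume "x \<in> D"
    with dir subspace_neg[OF D this] show "x \<in> dominated D"
      unfolding directed_set_def dominated_def by blast
  qed
next
  assume sub: "D \<subseteq> dominated D"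
  show "directed_set D"
    unfolding directed_set_def
  proof (intro ballI)
    fix x y assume "x \<in> D" "y \<in> D"
    with sub obtain d e where d: "d \<in> D" "x \<le> d" "- x \<le> d" and e: "e \<in> D" "y \<le> e" "- y \<le> e"
      unfolding dominated_def by blast
    have "x \<le> d + e" "y \<le> d + e"
      using d e nonneg_if_dominates[OF d(2,3)] nonneg_if_dominates[OF e(2,3)]
      by (simp_all add: add_increasing add_increasing2)
    then show "\<exists>z\<in>D. x \<le> z \<and> y \<le> z" using subspace_add[OF D d(1) e(1)] by blast
  qed
qed

lemma subset_generated_ideal: "M \<subseteq> generated_ideal M"
  unfolding generated_ideal_def by (rule hull_subset)

lemma generated_ideal_minimal: "M \<subseteq> J \<Longrightarrow> order_ideal J \<Longrightarrow> generated_ideal M \<subseteq> J"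
  unfolding generated_ideal_def by (rule hull_minimal)

lemma order_ideal_Inter:
  assumes "\<And>J. J \<in> \<J> \<Longrightarrow> order_ideal J"
  shows "order_ideal (\<Inter>\<J>)"
proof -
  have "subspace (\<Inter>\<J>)"
    using assms by (intro subspace_Inter) (auto simp: order_ideal_def)
  moreover have "solid (\<Inter>\<J>)"
    using assms unfolding order_ideal_def solid_def by (meson InterE InterI)
  ultimately show ?thesis by (simp add: order_ideal_def)
qed

lemma order_ideal_generated_ideal: "order_ideal (generated_ideal M)"
  unfolding generated_ideal_def by (rule hull_in, rule order_ideal_Inter) auto

text \<open>Leaving \<open>M\<close> free between the two bounds covers a whole subspace and its
  positive part alike.\<close>

lemma generated_ideal_eq_dominated:
  assumes "subspace D" "D \<inter> {0..} \<subseteq> M" "M \<subseteq> dominated D"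
  shows "generated_ideal M = dominated D"
proof
  show "generated_ideal M \<subseteq> dominated D"
    using assms by (intro generated_ideal_minimal order_ideal_dominated)
  show "dominated D \<subseteq> generated_ideal M"
    using assms(2) subset_generated_ideal[of M]
    by (intro dominated_subset_order_ideal order_ideal_generated_ideal) auto
qed

lemma bipositive_le_iff:
  assumes "bipositive i"
  shows "i x \<le> i y \<longleftrightarrow> x \<le> y"
proof -
  have "i x \<le> i y \<longleftrightarrow> 0 \<le> i (y - x)"
    using assms linear_diff[of i y x] by (simp add: bipositive_def)
  then show ?thesis using assms by (simp add: bipositive_def)
qed

text \<open>Every dominating element on the left has the form \<open>i d\<close>, so both
  inequalities can be pulled back along \<open>i\<close>.\<close>

lemma bipositive_dominated_iff:
  assumes "bipositive i"
  shows "i x \<in> dominated (i ` D) \<longleftrightarrow> x \<in> dominated D"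
proof -
  have "- i x = i (- x)" using assms by (simp add: bipositive_def linear_neg)
  then show ?thesis by (simp add: dominated_def bipositive_le_iff[OF assms])
qed

text \<open>The modulus of \<open>y\<close> has the same upper bounds as \<open>y\<close> and
  \<open>- y\<close> together. Through it a single majorant controls both signs.\<close>

lemma sup_uminus_in_order_ideal:
  fixes J :: "'b::{ordered_real_vector,lattice} set"
  assumes "order_ideal J" "y \<in> J"
  shows "sup y (- y) \<in> J"
proof -
  have "- sup y (- y) \<le> y" by (simp add: minus_le_iff)
  then have "upper_bounds {y, - y} \<subseteq> upper_bounds {sup y (- y), - sup y (- y)}"
    using order_trans[of "- sup y (- y)" y] by (auto simp: upper_bounds_pair_iff)
  then show ?thesis using assms unfolding order_ideal_def solid_def by blast
qed

text \<open>The preimage of the dominated set under \<open>i\<close> is \<open>dominated I\<close>,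
  which is \<open>I\<close> by assumption.\<close>

lemma extension_ideal_dominated:
  assumes "bipositive i" "subspace I" "dominated I = I"
  shows "extension_ideal i I (dominated (i ` I))"
proof -
  have "subspace (i ` I)" using assms by (simp add: bipositive_def linear_subspace_image)
  then show ?thesis
    using assms by (simp add: extension_ideal_def order_ideal_dominated bipositive_dominated_iff)
qed

theorem theorem16:
  fixes i :: "'a::ordered_real_vector \<Rightarrow> 'b::{ordered_real_vector,lattice}"
    and I :: "'a set"
  assumes "vector_lattice_cover i"
    and "order_ideal I"
  shows
    "let P1 = directed_set I;
         P2 = (\<exists>S\<subseteq>{0..}. I = generated_ideal S);
         P3 = majorizing_in (i ` I) (generated_ideal (i ` I));
         P4 = ((\<exists>J. extension_ideal i I J) \<and>
               (\<exists>S\<subseteq>{0..}. smallest_extension_ideal i I = generated_ideal (i ` S)))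
     in (P1 \<longleftrightarrow> P2) \<and> (P2 \<longleftrightarrow> P3) \<and> (P3 \<longleftrightarrow> P4) \<and>
        (P1 \<or> P2 \<or> P3 \<or> P4 \<longrightarrow>
           I = generated_ideal (I \<inter> {0..}) \<and>
           (\<exists>J. extension_ideal i I J) \<and>
           smallest_extension_ideal i I = generated_ideal (i ` (I \<inter> {0..})))"
proof -
  have bip: "bipositive i" using assms(1) by (simp add: vector_lattice_cover_def)
  have sub: "subspace I" using assms(2) by (simp add: order_ideal_def)
  have subi: "subspace (i ` I)"
    using bip sub by (simp add: bipositive_def linear_subspace_image)
  have pos: "i ` (S \<inter> {0..}) = i ` S \<inter> {0..}" for S
    using bip by (auto simp: bipositive_def)
  have directed_iff: "directed_set I \<longleftrightarrow> I \<subseteq> dominated I"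
    by (rule directed_set_iff_dominated[OF sub])

  define P2 where "P2 = (\<exists>S\<subseteq>{0..}. I = generated_ideal S)"
  define P3 where "P3 = majorizing_in (i ` I) (generated_ideal (i ` I))"
  define P4 where "P4 = ((\<exists>J. extension_ideal i I J) \<and>
    (\<exists>S\<subseteq>{0..}. smallest_extension_ideal i I = generated_ideal (i ` S)))"
  \<comment> \<open>\<open>Q\<close> states that \<open>S = I \<inter> {0..}\<close> works in (ii)
    and (iv), so it implies both. Once directedness yields \<open>P3\<close> and \<open>Q\<close>,
    only the three implications back to directedness remain.\<close>
  define Q where "Q = (I = generated_ideal (I \<inter> {0..}) \<and> (\<exists>J. extension_ideal i I J) \<and>
    smallest_extension_ideal i I = generated_ideal (i ` (I \<inter> {0..})))"

  have fwd: "P3 \<and> Q" if dir: "directed_set I"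
  proof -
    have dom: "dominated I = I"
      using dir directed_iff dominated_subset_order_ideal[OF assms(2), of I] by blast
    have idom: "i ` I \<subseteq> dominated (i ` I)"
      using dom by (auto simp: bipositive_dominated_iff[OF bip])
    have gen_all: "generated_ideal (i ` I) = dominated (i ` I)"
      using subi idom by (intro generated_ideal_eq_dominated) auto
    then have P3
      using subi idom by (auto simp: P3_def majorizing_in_def dominated_def)
    moreover have "generated_ideal (I \<inter> {0..}) = I"
      using generated_ideal_eq_dominated[OF sub order_refl nonneg_subset_dominated] dom by simp
    moreover have gen_pos: "generated_ideal (i ` (I \<inter> {0..})) = dominated (i ` I)"
      unfolding pos by (intro generated_ideal_eq_dominated subi order_refl nonneg_subset_dominated)
    moreover have ext: "extension_ideal i I (dominated (i ` I))"
      using bip sub dom by (rule extension_ideal_dominated)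
    moreover have "smallest_extension_ideal i I = dominated (i ` I)"
    proof
      show "smallest_extension_ideal i I \<subseteq> dominated (i ` I)"
        using ext by (auto simp: smallest_extension_ideal_def)
      \<comment> \<open>An extension ideal contains the image of \<open>I\<close>, in particular its
        positive elements.\<close>
      have "dominated (i ` I) \<subseteq> J" if "extension_ideal i I J" for J
        using that by (intro dominated_subset_order_ideal) (auto simp: extension_ideal_def)
      then show "dominated (i ` I) \<subseteq> smallest_extension_ideal i I"
        by (auto simp: smallest_extension_ideal_def)
    qed
    ultimately show ?thesis unfolding Q_def by metis
  qed

  have Q: "P2 \<and> P4" if Q
  proof -
    have "I \<inter> {0..} \<subseteq> {0..}" by simp
    with that show ?thesis unfolding P2_def P4_def Q_def by metis
  qed

  have "directed_set I" if P2
  proof -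
    from that obtain S where S: "S \<subseteq> {0..}" "I = generated_ideal S"
      unfolding P2_def by blast
    have "S \<subseteq> dominated I"
      using S subset_generated_ideal[of S] nonneg_subset_dominated[of I] by blast
    then have "generated_ideal S \<subseteq> dominated I"
      by (intro generated_ideal_minimal order_ideal_dominated sub)
    then show ?thesis using directed_iff S(2) by simp
  qed

  moreover have "directed_set I" if P3
  proof -
    have "x \<in> dominated I" if "x \<in> I" for x
    proof -
      have "i x \<in> generated_ideal (i ` I)" using that subset_generated_ideal by blast
      \<comment> \<open>Majorizing the modulus, rather than \<open>i x\<close> and
        \<open>- i x\<close> separately, gives one bound for both.\<close>
      then have "sup (i x) (- i x) \<in> generated_ideal (i ` I)"
        by (intro sup_uminus_in_order_ideal order_ideal_generated_ideal)
      then obtain d where "d \<in> i ` I" "sup (i x) (- i x) \<le> d"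
        using \<open>P3\<close> unfolding P3_def majorizing_in_def by blast
      then have "i x \<in> dominated (i ` I)" by (auto simp: dominated_def)
      then show ?thesis by (simp add: bipositive_dominated_iff[OF bip])
    qed
    then show ?thesis by (auto simp: directed_iff)
  qed

  moreover have "directed_set I" if P4
  proof -
    from that obtain S J where S: "S \<subseteq> {0..}" "smallest_extension_ideal i I = generated_ideal (i ` S)"
      and J: "extension_ideal i I J" unfolding P4_def by blast
    \<comment> \<open>The existence of an extension ideal enters here: \<open>J\<close> contains the
      smallest one, and taking preimages under \<open>i\<close> then forces \<open>S\<close> into
      \<open>I\<close>.\<close>
    have "i ` S \<subseteq> J"
      using J subset_generated_ideal[of "i ` S"] unfolding S(2)[symmetric]
      by (auto simp: smallest_extension_ideal_def)
    then have "S \<subseteq> I \<inter> {0..}" using J S(1) by (auto simp: extension_ideal_def)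
    then have "i ` S \<subseteq> dominated (i ` I)"
      using nonneg_subset_dominated[of "i ` I"] unfolding pos[symmetric] by blast
    then have "smallest_extension_ideal i I \<subseteq> dominated (i ` I)"
      unfolding S(2) by (intro generated_ideal_minimal order_ideal_dominated subi)
    moreover have "i ` I \<subseteq> smallest_extension_ideal i I"
      by (auto simp: smallest_extension_ideal_def extension_ideal_def)
    ultimately show ?thesis
      unfolding directed_iff using bipositive_dominated_iff[OF bip] by blast
  qed

  ultimately show ?thesis
    using fwd Q unfolding Let_def P2_def[symmetric] P3_def[symmetric] P4_def[symmetric] Q_def[symmetric]
    by blast
qed

end
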